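(* Let $p$ be a prime and let $f(n)=an+b\in\mathbb{Z}[n]$, where $a\neq 0$ and $\gcd(a,b)=1$. Consider the $p$-adic valuation tree of $\{\nu_p(f(n))\}_{n\ge 0}$. If $-\frac{b}{a}\in\mathbb{Z}_p$, then, for every $k\ge 0$, a non-terminating node at the $k$-th level splits into $p-1$ terminating nodes with valuation $k$ and one non-terminating node with valuation at least $k+1$.
   Context: For a prime $p$, $\nu_p$ is the usual $p$-adic valuation on $\mathbb{Q}$, with $\nu_p(0)=+\infty$; $\mathbb{Z}_p$ is the ring of $p$-adic integers. Valuation tree. Given a sequence of rational numbers $\{S_n\}_{n\ge 0}$, the $p$-adic valuation tree of $\{\nu_p(S_n)\}_{n\ge 0}$ is built as follows. The $0$-th level has a single node, containing all terms of the sequence. A node at level $k$ consists of the terms $S_m$ whose index $m$ has the form $m=c_0+c_1p+\cdots+c_{k-1}p^{k-1}+np^k$, $n\ge 0$, for fixed digits $0\le c_i\le p-1$. A node is terminating if $\nu_p(S_m)$ has the same value for all terms $S_m$ in the node (this common value is "the valuation" of the node); it is non-terminating if at least two terms in the node have different valuations. A terminating node does not split. A non-terminating node at level $k$ splits into the $p$ nodes at level $k+1$ whose indices are $m=c_0+\cdots+c_{k-1}p^{k-1}+c_kp^k+np^{k+1}$, $n\ge 0$, one for each $0\le c_k\le p-1$. A node has "valuation at least $v$" if $\nu_p(S_m)\ge v$ for all terms $S_m$ in it. *)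

theory Defs
  imports Complex_Main "HOL-Computational_Algebra.Primes" "HOL-Library.Extended_Real"
begin

definition padic_val :: "nat \<Rightarrow> rat \<Rightarrow> ereal" where
  "padic_val p q =
     (if q = 0 then \<infinity>
      else ereal (real (multiplicity (int p) (fst (quotient_of q)))
                - real (multiplicity (int p) (snd (quotient_of q)))))"

(* The rational numbers lying in the ring of p-adic integers {x : Q_p. v_p(x) >= 0}. *)
definition padic_integer_rats :: "nat \<Rightarrow> rat set" where
  "padic_integer_rats p = {q. 0 \<le> padic_val p q}"

(* A node at level k is encoded by its digits [c_0, ..., c_(k-1)], least significant first,
   so the level is the length of the list; this is the set of indices m of its terms. *)
definition node_indices :: "nat \<Rightarrow> nat list \<Rightarrow> nat set" where
  "node_indices p cs = {(\<Sum>i<length cs. cs ! i * p ^ i) + n * p ^ length cs | n. True}"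

definition node_terminating :: "nat \<Rightarrow> (nat \<Rightarrow> rat) \<Rightarrow> nat list \<Rightarrow> bool" where
  "node_terminating p S cs \<longleftrightarrow>
     (\<forall>m\<in>node_indices p cs. \<forall>m'\<in>node_indices p cs. padic_val p (S m) = padic_val p (S m'))"

(* Meaningful for terminating nodes: v is the common valuation. *)
definition node_has_val :: "nat \<Rightarrow> (nat \<Rightarrow> rat) \<Rightarrow> nat list \<Rightarrow> ereal \<Rightarrow> bool" where
  "node_has_val p S cs v \<longleftrightarrow> (\<forall>m\<in>node_indices p cs. padic_val p (S m) = v)"

definition node_val_at_least :: "nat \<Rightarrow> (nat \<Rightarrow> rat) \<Rightarrow> nat list \<Rightarrow> ereal \<Rightarrow> bool" where
  "node_val_at_least p S cs v \<longleftrightarrow> (\<forall>m\<in>node_indices p cs. v \<le> padic_val p (S m))"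

definition node_children :: "nat \<Rightarrow> (nat \<Rightarrow> rat) \<Rightarrow> nat list \<Rightarrow> nat list set" where
  "node_children p S cs = (if node_terminating p S cs then {} else {cs @ [c] | c. c < p})"

inductive_set val_tree :: "nat \<Rightarrow> (nat \<Rightarrow> rat) \<Rightarrow> nat list set"
  for p :: nat and S :: "nat \<Rightarrow> rat" where
  root: "[] \<in> val_tree p S"
| split: "cs \<in> val_tree p S \<Longrightarrow> ds \<in> node_children p S cs \<Longrightarrow> ds \<in> val_tree p S"

definition nonterminating_nodes_at :: "nat \<Rightarrow> (nat \<Rightarrow> rat) \<Rightarrow> nat \<Rightarrow> nat list set" where
  "nonterminating_nodes_at p S k =
     {cs \<in> val_tree p S. length cs = k \<and> \<not> node_terminating p S cs}"

end

theory Submission imports Defs begin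

text \<open>
  Let \<open>p\<close> be prime and \<open>f n = a * n + b\<close>.  Coprimality of \<open>a\<close> and \<open>b\<close> together with \<open>- b / a \<in> \<int>\<^sub>p\<close> forces \<open>p\<close> not to divide \<open>a\<close>
  (\<open>not_dvd_denominator\<close>).  The terms of the node at level \<open>k\<close> with smallest index \<open>r\<close> are the
  numbers \<open>a * r + b + a * n * p ^ k\<close>, all congruent modulo \<open>p ^ k\<close>.  If \<open>p ^ k\<close> does not divide
  \<open>a * r + b\<close>, they all have the valuation of \<open>a * r + b\<close>.  Otherwise \<open>a * r + b = p ^ k * z\<close>, and
  the terms are \<open>p ^ k * (z + a * n)\<close>, where \<open>z + a * n\<close> runs through all residues modulo \<open>p\<close>, so
  that the valuation \<open>k\<close> occurs and so does a larger one.  Hence the non-terminating nodes are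
  exactly those with \<open>p ^ k dvd a * r + b\<close> (\<open>node_terminating_iff\<close>).

  The child of such a node with new digit \<open>c\<close> consists of the terms \<open>p ^ k * (z + a * c + a * n * p)\<close>.
  These have valuation \<open>k\<close> unless \<open>p dvd z + a * c\<close>, which happens for exactly one digit \<open>c\<close>
  because \<open>a\<close> is invertible modulo \<open>p\<close>; for that digit the criterion shows that the child does not
  terminate.
\<close>

section \<open>The valuation of integers\<close>

lemma padic_val_of_int:
  "padic_val p (of_int z) = (if z = 0 then \<infinity> else ereal (real (multiplicity (int p) z)))"
  by (simp add: padic_val_def)

lemma le_padic_val_of_int_iff:
  assumes "prime p"
  shows "ereal (real k) \<le> padic_val p (of_int z) \<longleftrightarrow> int p ^ k dvd z"
proof (cases "z = 0")
  case True
  then show ?thesis by (simp add: padic_val_def)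
next
  case False
  moreover have "\<not> is_unit (int p)"
    using assms by (auto dest: prime_gt_1_nat)
  ultimately show ?thesis
    by (simp add: padic_val_of_int power_dvd_iff_le_multiplicity)
qed

lemma padic_val_of_int_eq_iff:
  assumes "prime p"
  shows "padic_val p (of_int z) = ereal (real k) \<longleftrightarrow> int p ^ k dvd z \<and> \<not> int p ^ Suc k dvd z"
proof -
  have "padic_val p (of_int z) = ereal (real k) \<longleftrightarrow>
      ereal (real k) \<le> padic_val p (of_int z) \<and> \<not> ereal (real (Suc k)) \<le> padic_val p (of_int z)"
    by (auto simp: padic_val_of_int)
  then show ?thesis
    using assms by (simp only: le_padic_val_of_int_iff)
qed

text \<open>The valuation of an integer not divisible by \<open>p ^ k\<close> depends only on its residue
  modulo \<open>p ^ k\<close>.\<close>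

lemma padic_val_of_int_cong:
  assumes "prime p" "\<not> int p ^ k dvd x" "int p ^ k dvd y - x"
  shows "padic_val p (of_int y) = padic_val p (of_int x)"
proof -
  from assms(2) have "x \<noteq> 0" by auto
  then obtain j where j: "padic_val p (of_int x) = ereal (real j)"
    by (simp add: padic_val_of_int)
  then have x: "int p ^ j dvd x" "\<not> int p ^ Suc j dvd x"
    using padic_val_of_int_eq_iff[OF assms(1)] by blast+
  have "j < k"
    using assms(2) x(1) by (meson dvd_trans le_imp_power_dvd not_less)
  then have d: "int p ^ Suc j dvd y - x"
    using assms(3) by (meson Suc_leI dvd_trans le_imp_power_dvd)
  then have "int p ^ j dvd y - x"
    by (meson dvd_trans le_imp_power_dvd lessI less_imp_le)
  with d x have "int p ^ j dvd y \<and> \<not> int p ^ Suc j dvd y"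
    by (metis diff_add_cancel dvd_add_right_iff)
  then have "padic_val p (of_int y) = ereal (real j)"
    using padic_val_of_int_eq_iff[OF assms(1)] by blast
  with j show ?thesis by simp
qed

text \<open>A prime dividing \<open>a\<close> does not divide the coprime \<open>b\<close>, so it would give \<open>- b / a\<close> a negative
  valuation.  The case distinction on the sign of \<open>a\<close> in the proof is due to the positive
  denominator returned by \<open>quotient_of\<close>.\<close>

lemma not_dvd_denominator:
  assumes p: "prime p" and a: "a \<noteq> 0" and "gcd a b = 1"
    and int: "- (of_int b / of_int a) \<in> padic_integer_rats p"
  shows "\<not> int p dvd a"
proof
  assume pa: "int p dvd a"
  have nu: "\<not> is_unit (int p)"
    using p by (auto dest: prime_gt_1_nat)
  have cop: "coprime a b"
    using assms(3) by (simp add: coprime_iff_gcd_eq_1)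
  then have pb: "\<not> int p dvd b"
    using pa nu coprime_common_divisor by blast
  then have b: "b \<noteq> 0" by auto
  have cop': "coprime (- b) a"
    using cop by (simp add: coprime_commute)
  have q: "- (of_int b / of_int a) = (Fract (- b) a :: rat)"
    by (simp add: Fract_of_int_quotient)
  obtain s where s: "s = 1 \<or> s = - 1" and quot: "quotient_of (Fract (- b) a) = (s * - b, s * a)"
  proof (cases "0 < a")
    case True
    then show ?thesis
      using that[of 1] cop' by (simp add: quotient_of_Fract)
  next
    case False
    then have "Fract (- b) a = Fract b (- a)" "0 < - a"
      using a by (simp_all add: eq_rat)
    then show ?thesis
      using that[of "- 1"] cop by (simp add: quotient_of_Fract coprime_commute)
  qed
  have "multiplicity (int p) (s * - b) = 0"
    using s pb by (auto intro: not_dvd_imp_multiplicity_0)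
  moreover have "0 < multiplicity (int p) (s * a)"
    using s pa a nu by (auto simp: multiplicity_gt_zero_iff)
  ultimately have "\<not> 0 \<le> padic_val p (- (of_int b / of_int a))"
    using a b unfolding q padic_val_def quot by (simp add: Fract_of_int_quotient)
  then show False
    using int by (simp add: padic_integer_rats_def)
qed

section \<open>Nodes of the tree of a linear polynomial\<close>

text \<open>The smallest index in the node with digits \<open>cs\<close>, written \<open>r\<close> above.\<close>

definition node_offset :: "nat \<Rightarrow> nat list \<Rightarrow> nat" where
  "node_offset p cs = (\<Sum>i<length cs. cs ! i * p ^ i)"

lemma node_indices_eq: "node_indices p cs = {node_offset p cs + n * p ^ length cs | n. True}"
  by (simp add: node_indices_def node_offset_def)

lemma node_offset_snoc: "node_offset p (cs @ [c]) = node_offset p cs + c * p ^ length cs"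
  by (simp add: node_offset_def nth_append)

lemma ex1_digit_root:
  fixes a z :: int
  assumes p: "prime p" and a: "\<not> int p dvd a"
  shows "\<exists>!c. c < p \<and> int p dvd z + a * int c"
proof -
  have p': "prime (int p)" "int p > 0"
    using p by (simp_all add: prime_gt_0_nat)
  have "coprime a (int p)"
    using p'(1) a prime_imp_coprime coprime_commute by blast
  then obtain u v where uv: "u * a + v * int p = 1"
    using bezout_int[of a "int p"] by (auto simp: coprime_iff_gcd_eq_1)
  \<comment> \<open>Modulo \<open>p\<close>, \<open>u\<close> is the inverse of \<open>a\<close>, so the root is the residue of \<open>- u * z\<close>.\<close>
  define c where "c = nat ((- u * z) mod int p)"
  have c: "int c = (- u * z) mod int p" "c < p"
    using p' by (simp_all add: c_def nat_less_iff)
  have "int p dvd - u * z - int c"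
    unfolding c(1) by (rule dvd_minus_mod)
  moreover have "z + a * int c = int p * (v * z) - a * (- u * z - int c)"
  proof -
    have "z = (u * a + v * int p) * z" using uv by simp
    then show ?thesis by (simp add: algebra_simps)
  qed
  ultimately have root: "int p dvd z + a * int c" by simp
  show ?thesis
  proof (intro ex1I[of _ c] conjI c(2) root)
    fix d assume d: "d < p \<and> int p dvd z + a * int d"
    have "int p dvd (z + a * int d) - (z + a * int c)"
      using d root by (blast intro: dvd_diff)
    then have "int p dvd a * (int d - int c)"
      by (simp add: algebra_simps)
    then have "int p dvd int d - int c"
      using p' a prime_dvd_mult_iff by blast
    then have "int d mod int p = int c mod int p"
      by (simp add: mod_eq_dvd_iff)
    then show "d = c"
      using d c(2) by simp
  qed
qed

context
  fixes p :: nat and a b :: int and f :: "nat \<Rightarrow> rat"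
  assumes prime: "prime p" and unit: "\<not> int p dvd a"
    and f: "\<And>n. f n = of_int (a * int n + b)"
begin

lemma f_node_term:
  "f (node_offset p cs + n * p ^ length cs)
     = of_int (a * int (node_offset p cs) + b + int p ^ length cs * (a * int n))"
  unfolding f by (simp add: algebra_simps)

lemma node_val_at_least_length:
  assumes "int p ^ length cs dvd a * int (node_offset p cs) + b"
  shows "node_val_at_least p f cs (ereal (real (length cs)))"
  unfolding node_val_at_least_def node_indices_eq
  using assms by (auto simp: f_node_term le_padic_val_of_int_iff[OF prime] simp del: of_int_add)

lemma node_has_val_offset:
  assumes "\<not> int p ^ length cs dvd a * int (node_offset p cs) + b"
  shows "node_has_val p f cs (padic_val p (of_int (a * int (node_offset p cs) + b)))"
proof -
  let ?x = "a * int (node_offset p cs) + b"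
  have "padic_val p (f (node_offset p cs + n * p ^ length cs)) = padic_val p (of_int ?x)" for n
    unfolding f_node_term by (rule padic_val_of_int_cong[OF prime assms]) simp
  then show ?thesis
    unfolding node_has_val_def node_indices_eq by blast
qed

lemma node_has_val_imp_terminating: "node_has_val p f cs v \<Longrightarrow> node_terminating p f cs"
  by (simp add: node_has_val_def node_terminating_def)

text \<open>The criterion holds for every digit list, whether or not it is a node of the tree.\<close>

lemma node_terminating_iff:
  "node_terminating p f cs \<longleftrightarrow> \<not> int p ^ length cs dvd a * int (node_offset p cs) + b"
proof
  assume "\<not> int p ^ length cs dvd a * int (node_offset p cs) + b"
  then show "node_terminating p f cs"
    using node_has_val_offset node_has_val_imp_terminating by blast
next
  assume const: "node_terminating p f cs"
  show "\<not> int p ^ length cs dvd a * int (node_offset p cs) + b"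
  proof
    let ?k = "length cs" and ?r = "node_offset p cs"
    have p0: "int p \<noteq> 0" using prime by (simp add: prime_gt_0_nat)
    assume "int p ^ ?k dvd a * int ?r + b"
    then obtain z where z: "a * int ?r + b = int p ^ ?k * z" by (rule dvdE)
    have le: "ereal (real (Suc ?k)) \<le> padic_val p (f (?r + n * p ^ ?k)) \<longleftrightarrow> int p dvd z + a * int n" for n
      unfolding f_node_term z le_padic_val_of_int_iff[OF prime] distrib_left[symmetric] power_Suc2
      using p0 by simp
    obtain c where c: "int p dvd z + a * int c"
      using ex1_digit_root[OF prime unit] by blast
    \<comment> \<open>The terms numbered \<open>c\<close> and \<open>c + 1\<close> have different valuations.\<close>
    have "\<not> int p dvd z + a * int (Suc c)"
    proof
      assume "int p dvd z + a * int (Suc c)"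
      then have "int p dvd (z + a * int (Suc c)) - (z + a * int c)"
        using c by (rule dvd_diff)
      then show False using unit by (simp add: algebra_simps)
    qed
    moreover have "padic_val p (f (?r + c * p ^ ?k)) = padic_val p (f (?r + Suc c * p ^ ?k))"
      using const unfolding node_terminating_def node_indices_eq by blast
    ultimately show False using le[of c] le[of "Suc c"] c by simp
  qed
qed

lemma nonterminating_node_splits:
  assumes nt: "\<not> node_terminating p f N"
  shows "\<exists>T M. node_children p f N = insert M T \<and> M \<notin> T \<and> card T = p - 1 \<and>
         (\<forall>N'\<in>T. node_terminating p f N' \<and> node_has_val p f N' (ereal (real (length N)))) \<and>
         \<not> node_terminating p f M \<and> node_val_at_least p f M (ereal (real (length N + 1)))"
proof -
  let ?k = "length N" and ?r = "node_offset p N"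
  have p0: "int p \<noteq> 0" using prime by (simp add: prime_gt_0_nat)
  obtain z where z: "a * int ?r + b = int p ^ ?k * z"
    using nt unfolding node_terminating_iff by blast
  have child: "a * int (node_offset p (N @ [c])) + b = int p ^ ?k * (z + a * int c)" for c
    unfolding node_offset_snoc distrib_left z[symmetric] by (simp add: algebra_simps)
  have dvd_iff: "int p ^ length (N @ [c]) dvd a * int (node_offset p (N @ [c])) + b
      \<longleftrightarrow> int p dvd z + a * int c" for c
    unfolding child using p0 by (simp add: power_Suc2 del: power_Suc)
  obtain c0 where c0: "c0 < p" "int p dvd z + a * int c0"
    and uniq: "\<And>c. c < p \<Longrightarrow> int p dvd z + a * int c \<Longrightarrow> c = c0"
    using ex1_digit_root[OF prime unit, of z] by blast
  define T where "T = (\<lambda>c. N @ [c]) ` ({..<p} - {c0})"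
  have "node_children p f N = insert (N @ [c0]) T"
    using nt c0(1) by (auto simp: node_children_def T_def)
  moreover have "N @ [c0] \<notin> T"
    by (auto simp: T_def)
  moreover have "card T = p - 1"
    using c0(1) by (simp add: T_def card_image inj_on_def)
  moreover have "node_terminating p f N' \<and> node_has_val p f N' (ereal (real ?k))" if N': "N' \<in> T" for N'
  proof -
    obtain c where c: "N' = N @ [c]" "c < p" "c \<noteq> c0"
      using N' by (auto simp: T_def)
    then have nd: "\<not> int p dvd z + a * int c" using uniq by blast
    then have "padic_val p (of_int (a * int (node_offset p N') + b)) = ereal (real ?k)"
      unfolding padic_val_of_int_eq_iff[OF prime] using dvd_iff[of c] child[of c] c(1) by simp
    then have "node_has_val p f N' (ereal (real ?k))"
      using node_has_val_offset[of N'] nd dvd_iff[of c] c(1) by simp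
    then show ?thesis using node_has_val_imp_terminating by blast
  qed
  moreover have "\<not> node_terminating p f (N @ [c0])"
    unfolding node_terminating_iff using dvd_iff c0(2) by blast
  moreover have "node_val_at_least p f (N @ [c0]) (ereal (real (?k + 1)))"
    using node_val_at_least_length[of "N @ [c0]"] dvd_iff c0(2) by simp
  ultimately show ?thesis
    by (intro exI[of _ T] exI[of _ "N @ [c0]"] conjI ballI) simp_all
qed

lemma nonterminating_nodes_at_nonempty: "nonterminating_nodes_at p f k \<noteq> {}"
proof (induction k)
  case 0
  have "[] \<in> nonterminating_nodes_at p f 0"
    by (simp add: nonterminating_nodes_at_def val_tree.root node_terminating_iff)
  then show ?case by blast
next
  case (Suc k)
  then obtain N where N: "N \<in> val_tree p f" "length N = k" "\<not> node_terminating p f N"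
    by (auto simp: nonterminating_nodes_at_def)
  obtain M where M: "M \<in> node_children p f N" "\<not> node_terminating p f M"
    using nonterminating_node_splits[OF N(3)] by blast
  then have "length M = Suc k"
    using N(2,3) by (auto simp: node_children_def)
  with M N(1) have "M \<in> nonterminating_nodes_at p f (Suc k)"
    by (simp add: nonterminating_nodes_at_def val_tree.split)
  then show ?case by blast
qed

end

section \<open>Splitting of the non-terminating nodes\<close>

theorem proposition3p1:
  fixes p :: nat and a b :: int and f :: "nat \<Rightarrow> rat"
  assumes "prime p"
    and "a \<noteq> 0"
    and "gcd a b = 1"
    and "\<And>n. f n = of_int (a * int n + b)"
    and "- (of_int b / of_int a) \<in> padic_integer_rats p"
  shows "\<forall>k. nonterminating_nodes_at p f k \<noteq> {} \<and>
    (\<forall>N\<in>nonterminating_nodes_at p f k.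
       \<exists>T M. node_children p f N = insert M T \<and> M \<notin> T \<and> card T = p - 1 \<and>
         (\<forall>N'\<in>T. node_terminating p f N' \<and> node_has_val p f N' (ereal (real k))) \<and>
         \<not> node_terminating p f M \<and> node_val_at_least p f M (ereal (real (k + 1))))"
proof (intro allI conjI ballI)
  have unit: "\<not> int p dvd a"
    by (rule not_dvd_denominator[OF assms(1,2,3,5)])
  fix k
  show "nonterminating_nodes_at p f k \<noteq> {}"
    by (rule nonterminating_nodes_at_nonempty[OF assms(1) unit assms(4)])
  fix N assume "N \<in> nonterminating_nodes_at p f k"
  then have "\<not> node_terminating p f N" and k: "k = length N"
    by (auto simp: nonterminating_nodes_at_def)
  then show "\<exists>T M. node_children p f N = insert M T \<and> M \<notin> T \<and> card T = p - 1 \<and>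
         (\<forall>N'\<in>T. node_terminating p f N' \<and> node_has_val p f N' (ereal (real k))) \<and>
         \<not> node_terminating p f M \<and> node_val_at_least p f M (ereal (real (k + 1)))"
    unfolding k by (intro nonterminating_node_splits[OF assms(1) unit assms(4)])
qed

end
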